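(* Let $\lambda$ be a nonzero real number and let $\alpha,n$ be nonnegative integers with $n\ge\alpha$. Then $$ \sum_{j=\alpha}^{n}{n \brace j}_{\lambda}j!\binom{(n-1)\lambda}{j-\alpha}=\alpha!{n \brace \alpha}_{-\lambda}=\sum_{j=\alpha}^{n}(-1)^{n-j}j!{n \brace j}_{\lambda}\binom{j-1}{\alpha-1}. $$
   Context: For a real parameter $\mu$ the degenerate falling factorials are $(x)_{0,\mu}=1$ and $(x)_{n,\mu}=x(x-\mu)\cdots(x-(n-1)\mu)$ for $n\ge1$; $(x)_n=(x)_{n,1}$ is the usual falling factorial. The degenerate Stirling numbers of the second kind ${n \brace k}_{\mu}$ are defined by $(x)_{n,\mu}=\sum_{k=0}^{n}{n \brace k}_{\mu}(x)_k$. For any real $x$ and integer $m\ge0$, $\binom{x}{m}=(x)_m/m!$. For $0\le\alpha\le j$, the symbol $\binom{j-1}{\alpha-1}$ is understood as $\binom{j-1}{j-\alpha}$ (agreeing with the usual value when $j\ge1$, and giving $\binom{-1}{-1}=1$). *)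

theory Defs
  imports Complex_Main
begin

definition deg_ffact :: "real \<Rightarrow> nat \<Rightarrow> real \<Rightarrow> real" where
  "deg_ffact \<mu> n x = (\<Prod>i<n. x - real i * \<mu>)"

abbreviation ffact :: "nat \<Rightarrow> real \<Rightarrow> real" where
  "ffact \<equiv> deg_ffact 1"

text \<open>
  The coefficients in the expansion of a degenerate falling factorial in the basis of
  ordinary falling factorials, extended by zero beyond index \<open>n\<close>. Existence and uniqueness
  are established by \<open>ex1_deg_stirling2\<close> below.
\<close>

definition deg_stirling2 :: "real \<Rightarrow> nat \<Rightarrow> nat \<Rightarrow> real" where
  "deg_stirling2 \<mu> n =
     (THE S. (\<forall>k>n. S k = 0) \<and> (\<forall>x. deg_ffact \<mu> n x = (\<Sum>k\<le>n. S k * ffact k x)))"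

lemma ffact_of_nat_eq_0: "m < k \<Longrightarrow> ffact k (real m) = 0"
  unfolding deg_ffact_def by (rule prod_zero) auto

lemma ffact_self_neq_0: "ffact m (real m) \<noteq> 0"
  unfolding deg_ffact_def by (auto simp: prod_zero_iff)

lemma ffact_expansion_unique:
  fixes S T :: "nat \<Rightarrow> real"
  assumes eq: "\<And>x. (\<Sum>k\<le>n. S k * ffact k x) = (\<Sum>k\<le>n. T k * ffact k x)"
    and "m \<le> n"
  shows "S m = T m"
  using \<open>m \<le> n\<close>
proof (induction m rule: less_induct)
  case (less m)
  have split: "(\<Sum>k\<le>n. U k * ffact k (real m))
      = (\<Sum>k<m. U k * ffact k (real m)) + U m * ffact m (real m)" for U :: "nat \<Rightarrow> real"
  proof -
    have "(\<Sum>k\<le>n. U k * ffact k (real m)) = (\<Sum>k\<le>m. U k * ffact k (real m))"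
      using less.prems by (intro sum.mono_neutral_right) (auto simp: ffact_of_nat_eq_0)
    then show ?thesis
      by (simp add: lessThan_Suc_atMost[symmetric])
  qed
  have "(\<Sum>k<m. S k * ffact k (real m)) = (\<Sum>k<m. T k * ffact k (real m))"
    using less by (intro sum.cong) auto
  then show ?case
    using eq[of "real m"] ffact_self_neq_0[of m] by (simp add: split)
qed

lemma ffact_expansion_exists:
  "\<exists>S. (\<forall>k>n. S k = 0) \<and> (\<forall>x. deg_ffact \<mu> n x = (\<Sum>k\<le>n. S k * ffact k x))"
proof (induction n)
  case 0
  show ?case
    by (rule exI[of _ "\<lambda>k. if k = 0 then 1 else 0"]) (simp add: deg_ffact_def)
next
  case (Suc n)
  then obtain S where S0: "\<And>k. k > n \<Longrightarrow> S k = 0"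
    and S: "\<And>x. deg_ffact \<mu> n x = (\<Sum>k\<le>n. S k * ffact k x)" by blast
  define T where "T k = (if k = 0 then 0 else S (k - 1)) + (real k - real n * \<mu>) * S k" for k
  have "deg_ffact \<mu> (Suc n) x = (\<Sum>k\<le>Suc n. T k * ffact k x)" for x
  proof -
    have "deg_ffact \<mu> (Suc n) x = (x - real n * \<mu>) * deg_ffact \<mu> n x"
      by (simp add: deg_ffact_def mult.commute)
    also have "\<dots> = (\<Sum>k\<le>n. S k * ffact (Suc k) x + (real k - real n * \<mu>) * S k * ffact k x)"
      unfolding S sum_distrib_left
      by (intro sum.cong) (auto simp: deg_ffact_def algebra_simps)
    also have "\<dots> = (\<Sum>k\<le>n. S k * ffact (Suc k) x)
        + (\<Sum>k\<le>n. (real k - real n * \<mu>) * S k * ffact k x)"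
      by (rule sum.distrib)
    also have "(\<Sum>k\<le>n. S k * ffact (Suc k) x)
        = (\<Sum>k\<le>Suc n. (if k = 0 then 0 else S (k - 1)) * ffact k x)"
      by (subst sum.atMost_Suc_shift) simp
    also have "(\<Sum>k\<le>n. (real k - real n * \<mu>) * S k * ffact k x)
        = (\<Sum>k\<le>Suc n. (real k - real n * \<mu>) * S k * ffact k x)"
      using S0[of "Suc n"] by simp
    finally show ?thesis
      unfolding T_def distrib_right sum.distrib .
  qed
  moreover have "\<forall>k>Suc n. T k = 0"
    by (auto simp: T_def S0)
  ultimately show ?case by blast
qed

lemma ex1_deg_stirling2:
  "\<exists>!S. (\<forall>k>n. S k = 0) \<and> (\<forall>x. deg_ffact \<mu> n x = (\<Sum>k\<le>n. S k * ffact k x))"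
proof (rule ex_ex1I[OF ffact_expansion_exists], elim conjE)
  fix S T :: "nat \<Rightarrow> real"
  assume S0: "\<forall>k>n. S k = 0" and S: "\<forall>x. deg_ffact \<mu> n x = (\<Sum>k\<le>n. S k * ffact k x)"
    and T0: "\<forall>k>n. T k = 0" and T: "\<forall>x. deg_ffact \<mu> n x = (\<Sum>k\<le>n. T k * ffact k x)"
  have eq: "(\<Sum>k\<le>n. S k * ffact k x) = (\<Sum>k\<le>n. T k * ffact k x)" for x
    using S T by metis
  show "S = T"
  proof
    fix k
    show "S k = T k"
      using ffact_expansion_unique[OF eq, of k] S0 T0 by (cases "k \<le> n") auto
  qed
qed

lemma deg_ffact_eq_sum_deg_stirling2:
  "deg_ffact \<mu> n x = (\<Sum>k\<le>n. deg_stirling2 \<mu> n k * ffact k x)"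
  using theI'[OF ex1_deg_stirling2[of n \<mu>]] unfolding deg_stirling2_def by blast

lemma deg_stirling2_eq_0: "k > n \<Longrightarrow> deg_stirling2 \<mu> n k = 0"
  using theI'[OF ex1_deg_stirling2[of n \<mu>]] unfolding deg_stirling2_def by blast

lemma gbinomial_eq_ffact: "x gchoose m = ffact m x / fact m"
  by (simp add: gbinomial_prod_rev deg_ffact_def atLeast0LessThan)

end

theory Submission
  imports Defs "HOL-Computational_Algebra.Formal_Power_Series"
begin

text \<open>
  The identities \<open>(x)\<^bsub>n,-\<lambda>\<^esub> = (x + (n-1)\<lambda>)\<^bsub>n,\<lambda>\<^esub>\<close> and \<open>(x)\<^bsub>n,-\<lambda>\<^esub> = (-1)\<^sup>n (-x)\<^bsub>n,\<lambda>\<^esub>\<close>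
  express \<open>(x)\<^bsub>n,-\<lambda>\<^esub>\<close> as combinations of the binomial coefficients of \<open>x + (n-1)\<lambda>\<close> over \<open>j\<close> and of
  \<open>x + (j-1)\<close> over \<open>j\<close>, respectively, the latter by upper negation. Vandermonde's
  convolution rewrites both in the basis of the \<open>(x)\<^sub>\<alpha>\<close>, where coefficients are unique.
\<close>

lemma deg_stirling2_eqI:
  assumes "\<And>x. deg_ffact \<mu> n x = (\<Sum>k\<le>n. T k * ffact k x)" and "k \<le> n"
  shows "deg_stirling2 \<mu> n k = T k"
proof (rule ffact_expansion_unique[OF _ assms(2)])
  show "(\<Sum>k\<le>n. deg_stirling2 \<mu> n k * ffact k x) = (\<Sum>k\<le>n. T k * ffact k x)" for x
    using deg_ffact_eq_sum_deg_stirling2[of \<mu> n x] assms(1)[of x] by (rule trans[OF sym])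
qed

text \<open>The shift \<open>y\<close> may vary with \<open>j\<close>: one identity takes the
  constant \<open>(real n - 1) * lam\<close>, the other \<open>real j - 1\<close>.\<close>

lemma fact_mult_deg_stirling2_shifted:
  fixes c y :: "nat \<Rightarrow> real"
  assumes expand: "\<And>x. deg_ffact \<mu> n x = (\<Sum>j\<le>n. c j * ((x + y j) gchoose j))"
    and "\<alpha> \<le> n"
  shows "fact \<alpha> * deg_stirling2 \<mu> n \<alpha> = (\<Sum>j=\<alpha>..n. c j * (y j gchoose (j - \<alpha>)))"
proof -
  \<comment> \<open>Dividing by \<open>fact k\<close> passes from \<open>x gchoose k\<close> to
    \<open>ffact k x\<close>; this is the source of \<open>fact \<alpha>\<close> in the
    conclusion.\<close>
  have "deg_ffact \<mu> n x = (\<Sum>k\<le>n. (\<Sum>j=k..n. c j * (y j gchoose (j - k))) / fact k * ffact k x)" for x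
  proof -
    have "deg_ffact \<mu> n x
        = (\<Sum>j\<le>n. \<Sum>k\<le>j. c j * ((x gchoose k) * (y j gchoose (j - k))))"
      unfolding expand sum_distrib_left[symmetric] atMost_atLeast0 gbinomial_Vandermonde ..
    also have "\<dots> = (\<Sum>k\<le>n. \<Sum>j=k..n. c j * ((x gchoose k) * (y j gchoose (j - k))))"
      unfolding sum.Sigma[OF finite_atMost ballI[OF finite_atMost]]
        sum.Sigma[OF finite_atMost ballI[OF finite_atLeastAtMost]]
      by (rule sum.reindex_bij_witness[of _ "\<lambda>(k, j). (j, k)" "\<lambda>(j, k). (k, j)"]) auto
    also have "\<dots> = (\<Sum>k\<le>n. (\<Sum>j=k..n. c j * (y j gchoose (j - k))) / fact k * ffact k x)"
      by (intro sum.cong refl)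
        (simp add: gbinomial_eq_ffact[of x] sum_distrib_left sum_divide_distrib mult_ac)
    finally show ?thesis .
  qed
  from deg_stirling2_eqI[OF this \<open>\<alpha> \<le> n\<close>] show ?thesis
    by simp
qed

lemma deg_ffact_eq_sum_gchoose:
  "deg_ffact \<mu> n x = (\<Sum>j\<le>n. deg_stirling2 \<mu> n j * fact j * (x gchoose j))"
  by (subst deg_ffact_eq_sum_deg_stirling2[of \<mu>]) (simp add: gbinomial_eq_ffact)

text \<open>Both products have the same factors in opposite order: index \<open>i\<close>
  corresponds to \<open>n - 1 - i\<close>.\<close>

lemma deg_ffact_uminus_eq_shift: "deg_ffact (- \<mu>) n x = deg_ffact \<mu> n (x + (real n - 1) * \<mu>)"
  unfolding deg_ffact_def
  by (subst prod.nat_diff_reindex[symmetric], rule prod.cong)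
    (auto simp: of_nat_diff algebra_simps)

lemma deg_ffact_uminus_eq_reflect: "deg_ffact (- \<mu>) n x = (- 1) ^ n * deg_ffact \<mu> n (- x)"
proof -
  have "deg_ffact (- \<mu>) n x = (\<Prod>i<n. - 1 * (- x - real i * \<mu>))"
    by (simp add: deg_ffact_def algebra_simps)
  then show ?thesis
    by (simp only: deg_ffact_def prod.distrib) simp
qed

theorem theorem2p4:
  fixes lam :: real and \<alpha> n :: nat
  assumes "lam \<noteq> 0" and "\<alpha> \<le> n"
  shows "(\<Sum>j=\<alpha>..n. deg_stirling2 lam n j * fact j * (((real n - 1) * lam) gchoose (j - \<alpha>)))
           = fact \<alpha> * deg_stirling2 (- lam) n \<alpha>
       \<and> fact \<alpha> * deg_stirling2 (- lam) n \<alpha>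
           = (\<Sum>j=\<alpha>..n. (-1) ^ (n - j) * fact j * deg_stirling2 lam n j
                        * ((real j - 1) gchoose (j - \<alpha>)))"
proof
  show "(\<Sum>j=\<alpha>..n. deg_stirling2 lam n j * fact j * (((real n - 1) * lam) gchoose (j - \<alpha>)))
      = fact \<alpha> * deg_stirling2 (- lam) n \<alpha>"
    by (rule fact_mult_deg_stirling2_shifted[OF _ \<open>\<alpha> \<le> n\<close>, symmetric])
      (simp add: deg_ffact_uminus_eq_shift deg_ffact_eq_sum_gchoose[of lam])
  have "deg_ffact (- lam) n x = (\<Sum>j\<le>n. (-1) ^ (n - j) * fact j * deg_stirling2 lam n j
      * ((x + (real j - 1)) gchoose j))" for x
  proof -
    \<comment> \<open>Upper negation of \<open>(- x) gchoose j\<close> contributes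
      \<open>(-1) ^ j\<close>, which combines with \<open>(-1) ^ n\<close> to
      \<open>(-1) ^ (n - j)\<close>. Here \<open>c\<close> stands for
      \<open>deg_stirling2 lam n j * fact j\<close>.\<close>
    have "(-1) ^ n * (c * ((- x) gchoose j)) = (-1) ^ (n - j) * c * ((x + (real j - 1)) gchoose j)"
      if "j \<le> n" for j and c :: real
    proof -
      have "(-1 :: real) ^ (n - j) = (-1) ^ n * (-1) ^ j"
        using that by (simp add: minus_one_power_iff)
      then show ?thesis
        by (simp add: gbinomial_minus add_diff_eq mult_ac)
    qed
    then show ?thesis
      unfolding deg_ffact_uminus_eq_reflect deg_ffact_eq_sum_gchoose[of lam] sum_distrib_left
      by (intro sum.cong) (simp_all add: mult_ac(1,2))
  qed
  then show "fact \<alpha> * deg_stirling2 (- lam) n \<alpha>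
      = (\<Sum>j=\<alpha>..n. (-1) ^ (n - j) * fact j * deg_stirling2 lam n j
                   * ((real j - 1) gchoose (j - \<alpha>)))"
    by (rule fact_mult_deg_stirling2_shifted[OF _ \<open>\<alpha> \<le> n\<close>])
qed

end
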